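(* Let $r\ge 0$ and let $f\in F_r$. Then $$|\flat f|\le C_{r+1},$$ where $C_n=\frac{1}{n+1}\binom{2n}{n}$ is the $n$-th Catalan number. Moreover, equality $|\flat f|=C_{r+1}$ holds if and only if $f$ equals $p=(2,4,\ldots,2r)$ up to shift, i.e. if and only if there is an integer $s$ with $f^{-1}(\times)=\{2+s,4+s,\ldots,2r+s\}$.
   Context: Let $F$ be the set of all functions $f:\mathbb{Z}\to\{\times,\cdot\}$ such that $f(a)=\cdot$ for all but finitely many $a\in\mathbb{Z}$. If $f^{-1}(\times)=\{a_1<a_2<\cdots<a_r\}$ we write $f=(a_1,\ldots,a_r)$ and $\#f=r$; let $F_r=\{f\in F:\#f=r\}$. Two elements $f=(a_1,\dots,a_r)$ and $g=(b_1,\dots,b_r)$ of $F_r$ are equal up to shift if $a_i-b_i$ is independent of $i$. A cap is an upper half-circle joining two integers $b<a$; it starts at $b$ and ends at $a$. For $g=(b_1,\ldots,b_r)\in F_r$, the cap diagram $D_{cap}(g)$ consists of $r$ caps, one starting at each $b_i$, constructed as follows: for $i=r,r-1,\ldots,1$ in turn, the cap starting at $b_i$ ends at the smallest integer $e>b_i$ such that $g(e)=\cdot$ and $e$ is not already the end of a previously constructed cap. For $f\in F_r$, we say $D_{cap}(g)$ matches the weight diagram of $f$ if every cap of $D_{cap}(g)$ has one endpoint $x$ with $f(x)=\cdot$ and the other endpoint $y$ with $f(y)=\times$. Define $$\flat f=\{g\in F_r : D_{cap}(g)\text{ matches the weight diagram of } f\}.$$ *)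

theory Defs
  imports Complex_Main
begin

datatype vertex_label = Cross | Dot

type_synonym weight_diagram = "int \<Rightarrow> vertex_label"

definition F :: "weight_diagram set" where
  "F = {f. finite {a. f a \<noteq> Dot}}"

definition crosses :: "weight_diagram \<Rightarrow> int set" where
  "crosses f = f -` {Cross}"

definition num_crosses :: "weight_diagram \<Rightarrow> nat" where
  "num_crosses f = card (crosses f)"

definition F_r :: "nat \<Rightarrow> weight_diagram set" where
  "F_r r = {f \<in> F. num_crosses f = r}"

text \<open>The sequence \<open>a\<^sub>1 < \<dots> < a\<^sub>r\<close> of crosses, indexed from 0.\<close>

definition cross_list :: "weight_diagram \<Rightarrow> int list" where
  "cross_list f = sorted_list_of_set (crosses f)"

definition equal_up_to_shift :: "weight_diagram \<Rightarrow> weight_diagram \<Rightarrow> bool" where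
  "equal_up_to_shift f g \<longleftrightarrow>
     num_crosses f = num_crosses g \<and>
     (\<forall>i < num_crosses f. \<forall>j < num_crosses f.
        cross_list f ! i - cross_list g ! i = cross_list f ! j - cross_list g ! j)"

text \<open>A cap is the pair (start, end). In \<open>cap_end\<close>, \<open>D\<close> is the set of caps constructed so far.
  For \<open>g \<in> F\<close> and finite \<open>D\<close> the least integer below exists: the admissible \<open>e\<close> are bounded
  below by \<open>b\<close> and include all sufficiently large integers.\<close>

definition cap_end :: "weight_diagram \<Rightarrow> (int \<times> int) set \<Rightarrow> int \<Rightarrow> int" where
  "cap_end g D b = (LEAST e. e > b \<and> g e = Dot \<and> e \<notin> snd ` D)"

fun add_caps :: "weight_diagram \<Rightarrow> int list \<Rightarrow> (int \<times> int) set \<Rightarrow> (int \<times> int) set" where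
  "add_caps g [] D = D"
| "add_caps g (b # bs) D = add_caps g bs (insert (b, cap_end g D b) D)"

text \<open>The crosses are processed from right to left.\<close>

definition D_cap :: "weight_diagram \<Rightarrow> (int \<times> int) set" where
  "D_cap g = add_caps g (rev (cross_list g)) {}"

definition cap_matches :: "(int \<times> int) set \<Rightarrow> weight_diagram \<Rightarrow> bool" where
  "cap_matches D f \<longleftrightarrow>
     (\<forall>(b, e) \<in> D. (f b = Dot \<and> f e = Cross) \<or> (f e = Dot \<and> f b = Cross))"

definition flat :: "weight_diagram \<Rightarrow> weight_diagram set" where
  "flat f = {g \<in> F_r (num_crosses f). cap_matches (D_cap g) f}"

definition catalan :: "nat \<Rightarrow> real" where
  "catalan n = 1 / (real n + 1) * real ((2 * n) choose n)"

text \<open>The weight diagram \<open>(2, 4, \<dots>, 2r)\<close>.\<close>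

definition p :: "nat \<Rightarrow> weight_diagram" where
  "p r = (\<lambda>a. if a \<in> {2 * int i | i. i \<in> {1..r}} then Cross else Dot)"

end

theory Submission imports Defs
begin

text \<open>
  Read \<open>f\<close> and \<open>g\<close> together from right to left. The free dots of \<open>g\<close> then form a stack: a dot is
  pushed, and a cross is capped with the top of the stack. Hence \<open>g \<in> flat f\<close> iff the two labels in
  \<open>f\<close> differ whenever a cross of \<open>g\<close> pops the stack, and only dots of \<open>f\<close> are left on the stack at the
  end. On reaching the rightmost cross of \<open>f\<close> (with \<open>m\<close> dots passed before), \<open>g\<close> either pops one of these
  dots or pushes; in the second case the pushed entry is popped after a balanced block
  with \<open>k\<close> crosses of \<open>f\<close>, which admits at most \<open>C\<^sub>k\<close> matchings. Induction gives the bound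
  \<open>C\<^sub>r + (\<Sum>k<r. C\<^sub>k C\<^sub>r\<^sub>-\<^sub>k) = C\<^sub>r\<^sub>+\<^sub>1\<close>. Equality forces, for every \<open>k < r\<close>, a dot of \<open>f\<close> at
  distance \<open>2k + 1\<close> from that cross with exactly \<open>k\<close> crosses strictly between, so the crosses have
  spacing 2; for such \<open>f\<close> all the estimates are equalities.
\<close>

section \<open>Catalan numbers\<close>

lemma catalan_0 [simp]: "catalan 0 = 1"
  by (simp add: catalan_def)

lemma catalan_pos [simp]: "catalan n > 0"
  by (simp add: catalan_def)

text \<open>Absorption links the central coefficients for \<open>n\<close> and \<open>Suc n\<close>
  through \<open>Suc (2 * n) choose n\<close>.\<close>

lemma catalan_step: "(real n + 2) * catalan (Suc n) = (4 * real n + 2) * catalan n"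
proof -
  have 1: "Suc n * (2 * Suc n choose Suc n) = (2 * Suc n) * (Suc (2 * n) choose n)"
    using Suc_times_binomial[of n "Suc (2*n)"] by simp
  have 2: "Suc n * (Suc (2 * n) choose n) = Suc (2 * n) * (2 * n choose n)"
  proof -
    have "Suc (2 * n) choose n = Suc (2 * n) choose Suc n"
      using binomial_symmetric[of n "Suc (2 * n)"] by (simp add: Suc_diff_le)
    then show ?thesis
      using Suc_times_binomial_eq[of "2 * n" n] by (simp only: mult.commute)
  qed
  have c1: "(real n + 1) * real (2 * Suc n choose Suc n) = 2 * (real n + 1) * real (Suc (2 * n) choose n)"
    using arg_cong[OF 1, of real] by (simp only: of_nat_mult) (simp add: algebra_simps)
  have c2: "(real n + 1) * real (Suc (2 * n) choose n) = (2 * real n + 1) * real (2 * n choose n)"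
    using arg_cong[OF 2, of real] by (simp only: of_nat_mult) (simp add: algebra_simps)
  have 3: "real (2 * Suc n choose Suc n) = 2 * real (Suc (2 * n) choose n)"
  proof -
    have "x = 2 * y" if "a * x = 2 * a * y" "a > 0" for a x y :: real using that by simp
    from this[OF c1] show ?thesis by simp
  qed
  have "(real n + 2) * catalan (Suc n) = 2 * real (Suc (2 * n) choose n)"
    unfolding catalan_def 3 by (simp add: field_simps)
  also have "\<dots> = 2 * ((2 * real n + 1) * real (2 * n choose n) / (real n + 1))"
    using c2 by (simp add: field_simps)
  also have "\<dots> = (4 * real n + 2) * catalan n"
    unfolding catalan_def by (simp add: field_simps)
  finally show ?thesis .
qed

text \<open>With \<open>S n\<close> the convolution and \<open>T n\<close> its version weighted by \<open>k + 1\<close>, the symmetry \<open>k \<leftrightarrow> n - k\<close>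
  gives \<open>2 T n = (n + 2) S n\<close>, and \<open>catalan_step\<close> expresses \<open>T (n + 1)\<close> through \<open>T n\<close> and \<open>S n\<close>.\<close>

lemma catalan_Suc: "catalan (Suc n) = (\<Sum>k\<le>n. catalan k * catalan (n - k))"
proof (induction n)
  case 0
  show ?case using catalan_step[of 0] by simp
next
  case (Suc n)
  define S where "S n = (\<Sum>k\<le>n. catalan k * catalan (n - k))" for n
  define T where "T n = (\<Sum>k\<le>n. (real k + 1) * (catalan k * catalan (n - k)))" for n
  have T: "2 * T m = (real m + 2) * S m" for m
  proof -
    have "T m = (\<Sum>k\<le>m. (real (m - k) + 1) * (catalan k * catalan (m - k)))"
      unfolding T_def
      by (rule sum.reindex_bij_witness[of _ "\<lambda>k. m - k" "\<lambda>k. m - k"]) auto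
    then have "2 * T m = (\<Sum>k\<le>m. (real k + 1) * (catalan k * catalan (m - k))
        + (real (m - k) + 1) * (catalan k * catalan (m - k)))"
      by (simp add: T_def sum.distrib)
    also have "\<dots> = (\<Sum>k\<le>m. (real m + 2) * (catalan k * catalan (m - k)))"
      by (rule sum.cong) (auto simp: of_nat_diff algebra_simps)
    finally show ?thesis by (simp add: S_def sum_distrib_left)
  qed
  have "T (Suc n) = catalan (Suc n)
      + (\<Sum>k\<le>n. ((real k + 2) * catalan (Suc k)) * catalan (n - k))"
    unfolding T_def by (subst sum.atMost_Suc_shift) (simp add: algebra_simps)
  also have "\<dots> = catalan (Suc n) + (\<Sum>k\<le>n. 4 * ((real k + 1) * (catalan k * catalan (n - k)))
      - 2 * (catalan k * catalan (n - k)))"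
    unfolding catalan_step by (simp add: algebra_simps)
  also have "\<dots> = catalan (Suc n) + 4 * T n - 2 * S n"
    by (simp add: sum_subtractf sum_distrib_left T_def S_def)
  finally have "2 * T (Suc n) = 2 * catalan (Suc n) + 4 * (2 * T n) - 4 * S n" by simp
  then have "(real n + 3) * S (Suc n) = 2 * catalan (Suc n) + 4 * ((real n + 2) * S n) - 4 * S n"
    unfolding T by (simp add: algebra_simps)
  also have "S n = catalan (Suc n)" using Suc by (simp add: S_def)
  finally have "(real n + 3) * S (Suc n) = (4 * real (Suc n) + 2) * catalan (Suc n)"
    by (simp add: algebra_simps)
  also have "\<dots> = (real n + 3) * catalan (Suc (Suc n))"
    using catalan_step[of "Suc n"] by (simp add: algebra_simps)
  finally show ?case by (simp add: S_def)
qed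

section \<open>Counting matchings with a stack\<close>

text \<open>The number of ways to process the labels \<open>w\<close> of \<open>f\<close> starting from the stack \<open>s\<close>, where \<open>c\<close> tells which
  final stacks are allowed; the first summand is a dot of \<open>g\<close>, the second a cross of \<open>g\<close>.\<close>

primrec cnt :: "(vertex_label list \<Rightarrow> bool) \<Rightarrow> vertex_label list \<Rightarrow> vertex_label list \<Rightarrow> nat" where
  "cnt c s [] = (if c s then 1 else 0)"
| "cnt c s (y # w) = cnt c (y # s) w
     + (case s of [] \<Rightarrow> 0 | z # t \<Rightarrow> if z \<noteq> y then cnt c t w else 0)"

text \<open>Two final conditions occur: a block under a cap must pop everything it pushes, while in
  the whole window uncapped dots of g may remain, provided that f has dots there.\<close>

abbreviation closed :: "vertex_label list \<Rightarrow> bool" where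
  "closed s \<equiv> s = []"

abbreviation dots_left :: "vertex_label list \<Rightarrow> bool" where
  "dots_left s \<equiv> Cross \<notin> set s"

text \<open>Since no final stack may contain \<open>z\<close> in this position, \<open>z\<close> is popped by some letter \<open>w ! i\<close>, and
  before that everything above \<open>z\<close> has been popped.\<close>

lemma cnt_split:
  assumes "\<And>t. \<not> c (t @ z # s)"
  shows "cnt c (t @ z # s) w = (\<Sum>i<length w. if w ! i \<noteq> z
           then cnt closed t (take i w) * cnt c s (drop (Suc i) w) else 0)"
proof (induction w arbitrary: t)
  case Nil
  then show ?case using assms by simp
next
  case (Cons y w)
  have push: "cnt c (y # t @ z # s) w = (\<Sum>i<length w. if w ! i \<noteq> z
           then cnt closed (y # t) (take i w) * cnt c s (drop (Suc i) w) else 0)"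
    using Cons[of "y # t"] by simp
  show ?case
  proof (cases t)
    case Nil
    with push show ?thesis
      by (simp add: sum.lessThan_Suc_shift del: sum.lessThan_Suc cong: if_cong)
  next
    case (Cons q t')
    with push Cons.IH[of t'] show ?thesis
      by (auto simp add: sum.lessThan_Suc_shift sum.distrib[symmetric] distrib_right
          simp del: sum.lessThan_Suc intro!: sum.cong cong: if_cong)
  qed
qed

text \<open>First-return decomposition: on the empty stack \<open>y\<close> can only be pushed, and
  the letter that pops it separates two independent closed runs.\<close>

lemma cnt_closed_Cons:
  "cnt closed [] (y # w) = (\<Sum>i<length w. if w ! i \<noteq> y
     then cnt closed [] (take i w) * cnt closed [] (drop (Suc i) w) else 0)"
  using cnt_split[of closed y "[]" "[]" w] by simp

text \<open>A dot of f cannot pop a dot, so pushing is the only move, and a stack of dots is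
  described by its height.\<close>

lemma cnt_dots_left_Dot:
  "cnt dots_left (replicate m Dot) (Dot # w) = cnt dots_left (replicate (Suc m) Dot) w"
  by (cases m) auto

text \<open>The cross pops one of the \<open>m\<close> dots or is pushed; a pushed cross may not
  survive to the end, so \<open>cnt_split\<close> locates the dot that pops it.\<close>

lemma cnt_dots_left_Cross:
  "cnt dots_left (replicate m Dot) (Cross # w) =
     (if m = 0 then 0 else cnt dots_left (replicate (m - 1) Dot) w)
     + (\<Sum>i<length w. if w ! i = Dot
         then cnt closed [] (take i w) * cnt dots_left (replicate m Dot) (drop (Suc i) w) else 0)"
proof -
  have "(x \<noteq> Cross) = (x = Dot)" for x by (cases x) auto
  then show ?thesis
    using cnt_split[of dots_left Cross "replicate m Dot" "[]" w] by (cases m) auto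
qed

text \<open>Every pop pairs an entry with a letter of the opposite label. Counting word and stack
  together avoids subtraction.\<close>

lemma cnt_closed_balanced:
  "cnt closed s w \<noteq> 0 \<Longrightarrow>
     count_list w Cross + count_list s Cross = count_list w Dot + count_list s Dot"
proof (induction w arbitrary: s)
  case Nil
  then show ?case by (auto split: if_splits)
next
  case (Cons y w)
  from Cons.prems consider "cnt closed (y # s) w \<noteq> 0"
    | z t where "s = z # t" "z \<noteq> y" "cnt closed t w \<noteq> 0"
    by (auto split: list.splits if_splits)
  then show ?case
  proof cases
    case 1
    from Cons.IH[OF this] show ?thesis by (cases y) auto
  next
    case 2
    from Cons.IH[OF 2(3)] 2(1,2) show ?thesis by (cases y; cases z) auto
  qed
qed

lemma length_count_labels: "length w = count_list w Cross + count_list w Dot"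
proof (induction w)
  case (Cons y w)
  then show ?case by (cases y) auto
qed simp

lemma cnt_closed_length:
  "cnt closed [] w \<noteq> 0 \<Longrightarrow> length w = 2 * count_list w Cross"
  using cnt_closed_balanced[of "[]" w] length_count_labels[of w] by simp

lemma cnt_closed_odd: "odd (length w) \<Longrightarrow> cnt closed [] w = 0"
  using cnt_closed_length[of w] by (metis dvd_triv_left)

text \<open>First-return sums live on even indices because closed blocks have even length. The
  bounds \<open>n\<close> and \<open>2 * l\<close> need not agree, so vanishing is required on
  either side of the mismatch.\<close>

lemma sum_even_indices:
  fixes h :: "nat \<Rightarrow> 'a::comm_monoid_add"
  assumes "\<And>i. i < n \<Longrightarrow> odd i \<Longrightarrow> h i = 0" "\<And>k. k < l \<Longrightarrow> n \<le> 2 * k \<Longrightarrow> h (2 * k) = 0"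
    "\<And>k. l \<le> k \<Longrightarrow> 2 * k < n \<Longrightarrow> h (2 * k) = 0"
  shows "(\<Sum>i<n. h i) = (\<Sum>k<l. h (2 * k))"
proof -
  have "(\<Sum>k<l. h (2 * k)) = (\<Sum>i\<in>(*) 2 ` {..<l}. h i)"
    by (subst sum.reindex) (auto simp: inj_on_def)
  also have "\<dots> = (\<Sum>i<n. h i)"
  proof (rule sum.mono_neutral_cong)
    fix i assume "i \<in> {..<n} - (*) 2 ` {..<l}"
    then have i: "i < n" "i \<notin> (*) 2 ` {..<l}" by auto
    show "h i = 0"
    proof (cases "even i")
      case True
      then obtain k where "i = 2 * k" by (elim evenE)
      with i have "l \<le> k" by (metis imageI lessThan_iff not_le)
      with i(1) \<open>i = 2 * k\<close> show ?thesis using assms(3) by simp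
    qed (use i(1) assms(1) in simp)
  next
    fix i assume "i \<in> (*) 2 ` {..<l} - {..<n}"
    then show "h i = 0" using assms(2) by auto
  qed auto
  finally show ?thesis by simp
qed

text \<open>In the first-return decomposition each even summand is, by induction, at most the
  corresponding term of the Catalan convolution.\<close>

lemma cnt_closed_le: "length w = 2 * k \<Longrightarrow> real (cnt closed [] w) \<le> catalan k"
proof (induction k arbitrary: w rule: less_induct)
  case (less k)
  show ?case
  proof (cases w)
    case Nil
    with less show ?thesis by simp
  next
    case (Cons y w')
    with less.prems obtain n where n: "k = Suc n" by (cases k) auto
    with Cons less.prems have len: "length w' = 2 * n + 1" by simp
    define h where "h i = (if i < length w' \<and> w' ! i \<noteq> y then real (cnt closed [] (take i w'))
        * real (cnt closed [] (drop (Suc i) w')) else 0)" for i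
    have "real (cnt closed [] w) = (\<Sum>i<length w'. h i)"
      unfolding Cons cnt_closed_Cons of_nat_sum by (rule sum.cong) (simp_all add: h_def)
    also have "\<dots> = (\<Sum>k<Suc n. h (2 * k))"
    proof (rule sum_even_indices)
      fix i assume "i < length w'" "odd i"
      then have "cnt closed [] (take i w') = 0"
        using cnt_closed_odd[of "take i w'"] by simp
      then show "h i = 0" by (simp add: h_def)
    qed (simp_all add: h_def len)
    also have "\<dots> \<le> (\<Sum>k\<le>n. catalan k * catalan (n - k))"
      unfolding lessThan_Suc_atMost
    proof (rule sum_mono)
      fix j assume "j \<in> {..n}"
      then have j: "j \<le> n" by simp
      have "real (cnt closed [] (take (2 * j) w')) \<le> catalan j"
        using j n len by (intro less.IH) auto
      moreover have "real (cnt closed [] (drop (Suc (2 * j)) w')) \<le> catalan (n - j)"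
        using j n len by (intro less.IH) auto
      ultimately show "h (2 * j) \<le> catalan j * catalan (n - j)"
        using catalan_pos[of j] catalan_pos[of "n - j"]
        by (auto simp: h_def intro!: mult_mono)
    qed
    finally show ?thesis by (simp add: n catalan_Suc)
  qed
qed

lemma count_list_labels_take_drop:
  assumes "i < length w" "w ! i = Dot"
  shows "count_list w Cross = count_list (take i w) Cross + count_list (drop (Suc i) w) Cross"
proof -
  have "w = take i w @ Dot # drop (Suc i) w" using assms by (metis id_take_nth_drop)
  then have "count_list w Cross = count_list (take i w @ Dot # drop (Suc i) w) Cross" by simp
  then show ?thesis by simp
qed

text \<open>The contribution of the cap that starts at \<open>w ! i\<close> and ends at a cross of \<open>f\<close> preceding \<open>w\<close>.\<close>

definition split_term :: "nat \<Rightarrow> vertex_label list \<Rightarrow> nat \<Rightarrow> real" where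
  "split_term m w i = (if i < length w \<and> w ! i = Dot
     then real (cnt closed [] (take i w)) * real (cnt dots_left (replicate m Dot) (drop (Suc i) w))
     else 0)"

text \<open>A nonzero summand makes the prefix closed, hence balanced, which fixes the number of
  crosses before the popping dot. This rigidity drives the equality case.\<close>

lemma split_term_nonzero:
  assumes "split_term m w (2 * k) \<noteq> 0"
  shows "2 * k < length w" "w ! (2 * k) = Dot" "count_list (take (2 * k) w) Cross = k"
    "count_list (drop (Suc (2 * k)) w) Cross = count_list w Cross - k" "k \<le> count_list w Cross"
proof -
  show 1: "2 * k < length w" and 2: "w ! (2 * k) = Dot"
    using assms by (auto simp: split_term_def split: if_splits)
  have "cnt closed [] (take (2 * k) w) \<noteq> 0"
    using assms by (auto simp: split_term_def split: if_splits)
  from cnt_closed_length[OF this] 1 show 3: "count_list (take (2 * k) w) Cross = k" by simp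
  from count_list_labels_take_drop[OF 1 2] 3
  show "count_list (drop (Suc (2 * k)) w) Cross = count_list w Cross - k" "k \<le> count_list w Cross"
    by auto
qed

text \<open>Indexing by the number of crosses in the closed block gives the sum the range of a
  Catalan convolution, whatever the length of \<open>w\<close>.\<close>

lemma cnt_dots_left_Cross_real:
  "real (cnt dots_left (replicate m Dot) (Cross # w)) =
     (if m = 0 then 0 else real (cnt dots_left (replicate (m - 1) Dot) w))
     + (\<Sum>k\<le>count_list w Cross. split_term m w (2 * k))"
proof -
  have "real (cnt dots_left (replicate m Dot) (Cross # w)) =
     (if m = 0 then 0 else real (cnt dots_left (replicate (m - 1) Dot) w))
     + (\<Sum>i<length w. split_term m w i)"
    unfolding cnt_dots_left_Cross of_nat_add of_nat_sum
    by (intro arg_cong2[where f = "(+)"] sum.cong) (simp_all add: split_term_def)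
  also have "(\<Sum>i<length w. split_term m w i) = (\<Sum>k<Suc (count_list w Cross). split_term m w (2 * k))"
  proof (rule sum_even_indices)
    fix i assume "i < length w" "odd i"
    then have "cnt closed [] (take i w) = 0"
      using cnt_closed_odd[of "take i w"] by simp
    then show "split_term m w i = 0" by (simp add: split_term_def)
  next
    fix k assume "Suc (count_list w Cross) \<le> k"
    then show "split_term m w (2 * k) = 0"
      using split_term_nonzero(5)[of m w k] by fastforce
  qed (simp_all add: split_term_def)
  finally show ?thesis by (simp only: lessThan_Suc_atMost)
qed

text \<open>The last term of the convolution is split off to match the runs in which a cross of f
  pops a dot.\<close>

lemma catalan_Suc_Suc:
  "catalan (Suc (Suc n)) = catalan (Suc n) + (\<Sum>k\<le>n. catalan k * catalan (Suc (n - k)))"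
proof -
  have "(\<Sum>k\<le>n. catalan k * catalan (Suc n - k)) = (\<Sum>k\<le>n. catalan k * catalan (Suc (n - k)))"
    by (rule sum.cong) (auto simp: Suc_diff_le)
  then show ?thesis by (simp add: catalan_Suc[of "Suc n"])
qed

text \<open>The bound for shorter words is a hypothesis, so that the estimate serves both inside the
  induction for \<open>cnt_dots_left_le\<close> and later in the equality case.\<close>

lemma split_term_le:
  assumes "k \<le> count_list w Cross"
    and "\<And>v. length v < length w \<Longrightarrow>
      real (cnt dots_left (replicate m Dot) v) \<le> catalan (Suc (count_list v Cross))"
  shows "split_term m w (2 * k) \<le> catalan k * catalan (Suc (count_list w Cross - k))"
proof (cases "split_term m w (2 * k) = 0")
  case True
  then show ?thesis using catalan_pos[of k] catalan_pos[of "Suc (count_list w Cross - k)"]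
    by (simp add: less_imp_le)
next
  case False
  note nz = split_term_nonzero[OF this]
  have "real (cnt closed [] (take (2 * k) w)) \<le> catalan k"
    using nz(1) by (intro cnt_closed_le) simp
  moreover have "real (cnt dots_left (replicate m Dot) (drop (Suc (2 * k)) w))
      \<le> catalan (Suc (count_list w Cross - k))"
    using assms(2)[of "drop (Suc (2 * k)) w"] nz(1,4) by simp
  ultimately show ?thesis
    using catalan_pos[of k] catalan_pos[of "Suc (count_list w Cross - k)"]
    by (simp add: split_term_def nz(1,2) mult_mono)
qed

lemma cnt_dots_left_le:
  "real (cnt dots_left (replicate m Dot) w) \<le> catalan (Suc (count_list w Cross))"
proof (induction "length w" arbitrary: m w rule: less_induct)
  case less
  show ?case
  proof (cases w)
    case Nil
    then show ?thesis by (simp add: catalan_Suc)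
  next
    case (Cons y v)
    show ?thesis
    proof (cases y)
      case Dot
      then show ?thesis
        unfolding Cons Dot cnt_dots_left_Dot using less[of v "Suc m"] by (simp add: Cons)
    next
      case Cross
      have "(\<Sum>k\<le>count_list v Cross. split_term m v (2 * k))
          \<le> (\<Sum>k\<le>count_list v Cross. catalan k * catalan (Suc (count_list v Cross - k)))"
        by (intro sum_mono split_term_le less) (auto simp: Cons)
      moreover have "(if m = 0 then 0 else real (cnt dots_left (replicate (m - 1) Dot) v))
          \<le> catalan (Suc (count_list v Cross))"
        using less[of v "m - 1"] catalan_pos[of "Suc (count_list v Cross)"] by (simp add: Cons less_imp_le)
      ultimately show ?thesis
        unfolding Cons Cross cnt_dots_left_Cross_real by (simp add: catalan_Suc_Suc)
    qed
  qed
qed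

lemma cnt_dots_left_eq_catalan:
  assumes "real (cnt dots_left (replicate m Dot) w) = catalan (Suc (count_list w Cross))"
  shows "\<exists>a. \<forall>k<count_list w Cross. a + 2 * k < length w \<and> w ! (a + 2 * k) = Cross"
  using assms
proof (induction w arbitrary: m)
  case (Cons y w)
  show ?case
  proof (cases y)
    case Dot
    have "real (cnt dots_left (replicate (Suc m) Dot) w) = catalan (Suc (count_list w Cross))"
      using Cons.prems unfolding Dot cnt_dots_left_Dot by simp
    from Cons.IH[OF this] obtain a
      where "\<forall>k<count_list w Cross. a + 2 * k < length w \<and> w ! (a + 2 * k) = Cross" by blast
    with Dot have "\<forall>k<count_list (y # w) Cross. Suc a + 2 * k < length (y # w)
        \<and> (y # w) ! (Suc a + 2 * k) = Cross" by simp
    then show ?thesis by blast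
  next
    case Cross
    define n where "n = count_list w Cross"
    have le: "split_term m w (2 * k) \<le> catalan k * catalan (Suc (n - k))" if "k \<le> n" for k
      using that unfolding n_def by (intro split_term_le cnt_dots_left_le)
    \<comment> \<open>The pop summand cannot exceed \<open>catalan (Suc n)\<close>, so nothing could
      compensate for a vanishing split term.\<close>
    have tight: "split_term m w (2 * k) \<noteq> 0" if k: "k \<le> n" for k
    proof
      assume "split_term m w (2 * k) = 0"
      then have "(\<Sum>k\<le>n. split_term m w (2 * k)) < (\<Sum>k\<le>n. catalan k * catalan (Suc (n - k)))"
        using le k by (intro sum_strict_mono_ex1) (auto intro!: bexI[of _ k])
      moreover have "(if m = 0 then 0 else real (cnt dots_left (replicate (m - 1) Dot) w))
          \<le> catalan (Suc n)"
        using cnt_dots_left_le[of "m - 1" w] catalan_pos[of "Suc n"] by (simp add: n_def less_imp_le)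
      ultimately show False
        using Cons.prems catalan_Suc_Suc[of n]
        unfolding Cross cnt_dots_left_Cross_real by (simp add: n_def)
    qed
    note nz = split_term_nonzero[OF tight]
    \<comment> \<open>The prefixes of lengths \<open>2 * k\<close> and \<open>2 * Suc k\<close>
      contain \<open>k\<close> and \<open>Suc k\<close> crosses, and the first of the two letters
      between them is a dot.\<close>
    have odd_Cross: "w ! Suc (2 * k) = Cross" if "k < n" for k
    proof -
      have len: "2 * Suc k < length w" using nz(1)[of "Suc k"] that by simp
      then have "take (2 * Suc k) w = take (2 * k) w @ [w ! (2 * k), w ! Suc (2 * k)]"
        by (simp add: take_Suc_conv_app_nth)
      then have "count_list (take (2 * Suc k) w) Cross
          = count_list (take (2 * k) w) Cross + count_list [w ! (2 * k), w ! Suc (2 * k)] Cross"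
        by simp
      then show ?thesis
        using nz(3)[of k] nz(3)[of "Suc k"] nz(2)[of k] that by (auto split: if_splits)
    qed
    have "2 * k < length (y # w) \<and> (y # w) ! (2 * k) = Cross" if "k < count_list (y # w) Cross" for k
    proof (cases k)
      case (Suc j)
      with that have "j < n" by (simp add: Cross n_def)
      with odd_Cross[OF this] nz(1)[of "Suc j"] show ?thesis by (simp add: Suc)
    qed (simp add: Cross)
    then show ?thesis by (intro exI[of _ 0]) simp
  qed
qed simp

section \<open>Alternating words attain the bounds\<close>

primrec alternating :: "vertex_label \<Rightarrow> vertex_label \<Rightarrow> nat \<Rightarrow> vertex_label list" where
  "alternating y z 0 = []"
| "alternating y z (Suc n) = y # z # alternating y z n"

lemma length_alternating [simp]: "length (alternating y z n) = 2 * n"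
  by (induction n) auto

lemma nth_alternating: "i < 2 * n \<Longrightarrow> alternating y z n ! i = (if even i then y else z)"
  by (induction n arbitrary: i) (auto simp: nth_Cons split: nat.splits)

lemma count_list_alternating: "count_list (alternating Cross Dot n) Cross = n"
  by (induction n) auto

text \<open>The left block has its letters swapped, which is why the induction in
  \<open>cnt_closed_alternating\<close> varies \<open>y\<close> and \<open>z\<close>.\<close>

lemma alternating_split:
  "j \<le> n \<Longrightarrow> z # alternating y z n = alternating z y j @ z # alternating y z (n - j)"
proof (induction j arbitrary: n)
  case (Suc j)
  then obtain n' where "n = Suc n'" by (cases n) auto
  with Suc show ?case by simp
qed simp

text \<open>Every even index is admissible and both blocks alternate again, so the estimates of
  \<open>cnt_closed_le\<close> become equalities.\<close>

lemma cnt_closed_alternating: "y \<noteq> z \<Longrightarrow> real (cnt closed [] (alternating y z n)) = catalan n"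
proof (induction n arbitrary: y z rule: less_induct)
  case (less n)
  show ?case
  proof (cases n)
    case (Suc k)
    define w where "w = z # alternating y z k"
    define h where "h i = (if i < length w \<and> w ! i \<noteq> y then real (cnt closed [] (take i w))
        * real (cnt closed [] (drop (Suc i) w)) else 0)" for i
    have len: "length w = 2 * k + 1" by (simp add: w_def)
    have "real (cnt closed [] (alternating y z n)) = (\<Sum>i<length w. h i)"
      unfolding Suc alternating.simps w_def[symmetric] cnt_closed_Cons of_nat_sum
      by (rule sum.cong) (simp_all add: h_def)
    also have "\<dots> = (\<Sum>j<Suc k. h (2 * j))"
    proof (rule sum_even_indices)
      fix i assume "i < length w" "odd i"
      then have "cnt closed [] (take i w) = 0"
        using cnt_closed_odd[of "take i w"] by simp
      then show "h i = 0" by (simp add: h_def)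
    qed (simp_all add: h_def len)
    also have "\<dots> = (\<Sum>j\<le>k. catalan j * catalan (k - j))"
      unfolding lessThan_Suc_atMost
    proof (rule sum.cong)
      fix j assume "j \<in> {..k}"
      then have j: "j \<le> k" by simp
      have w: "w = alternating z y j @ z # alternating y z (k - j)"
        unfolding w_def using j by (rule alternating_split)
      have "w ! (2 * j) = z" "take (2 * j) w = alternating z y j"
        "drop (Suc (2 * j)) w = alternating y z (k - j)"
        by (simp_all add: w nth_append)
      then show "h (2 * j) = catalan j * catalan (k - j)"
        using less.prems j by (simp add: h_def len less.IH Suc)
    qed simp
    finally show ?thesis by (simp add: Suc catalan_Suc)
  qed simp
qed

lemma cnt_dots_left_replicate: "cnt dots_left (replicate m Dot) (replicate q Dot) = 1"
proof (induction q arbitrary: m)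
  case (Suc q)
  then show ?case by (simp only: replicate_Suc[of q] cnt_dots_left_Dot)
qed simp

text \<open>One dot on the stack keeps the pop summand alive. The dot after the cross replaces the
  popped one, so the induction hypothesis applies at the same height.\<close>

lemma cnt_dots_left_alternating:
  "real (cnt dots_left (replicate (Suc m) Dot) (alternating Cross Dot n @ replicate q Dot))
     = catalan (Suc n)"
proof (induction n arbitrary: m rule: less_induct)
  case (less n)
  show ?case
  proof (cases n)
    case 0
    then show ?thesis
      using cnt_dots_left_replicate[of "Suc m" q] by (simp del: replicate.simps add: catalan_Suc)
  next
    case (Suc k)
    define w where "w = Dot # alternating Cross Dot k @ replicate q Dot"
    have len: "length w = 2 * k + 1 + q" by (simp add: w_def)
    have count: "count_list w Cross = k"
      by (simp add: w_def count_list_alternating)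
    have "real (cnt dots_left (replicate (Suc m) Dot) (alternating Cross Dot n @ replicate q Dot))
      = real (cnt dots_left (replicate m Dot) w) + (\<Sum>j\<le>k. split_term (Suc m) w (2 * j))"
      using cnt_dots_left_Cross_real[of "Suc m" w] unfolding count by (simp add: Suc w_def)
    also have "real (cnt dots_left (replicate m Dot) w) = catalan (Suc k)"
      unfolding w_def cnt_dots_left_Dot using less.IH[of k m] by (simp add: Suc)
    also have "(\<Sum>j\<le>k. split_term (Suc m) w (2 * j)) = (\<Sum>j\<le>k. catalan j * catalan (Suc (k - j)))"
    proof (rule sum.cong)
      fix j assume "j \<in> {..k}"
      then have j: "j \<le> k" by simp
      have w: "w = alternating Dot Cross j @ Dot # alternating Cross Dot (k - j) @ replicate q Dot"
        unfolding w_def using alternating_split[OF j, of Dot Cross] by (metis append_Cons append_assoc)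
      have "w ! (2 * j) = Dot" "take (2 * j) w = alternating Dot Cross j"
        "drop (Suc (2 * j)) w = alternating Cross Dot (k - j) @ replicate q Dot"
        by (simp_all add: w nth_append)
      then show "split_term (Suc m) w (2 * j) = catalan j * catalan (Suc (k - j))"
        using j less.IH[of "k - j" m] cnt_closed_alternating[of Dot Cross j]
        by (simp add: split_term_def len Suc)
    qed simp
    finally show ?thesis by (simp add: Suc catalan_Suc_Suc)
  qed
qed

lemma cnt_dots_left_replicate_append:
  "cnt dots_left (replicate m Dot) (replicate a Dot @ w) = cnt dots_left (replicate (m + a) Dot) w"
proof (induction a arbitrary: m)
  case (Suc a)
  show ?case
    unfolding replicate_Suc[of a] append_Cons cnt_dots_left_Dot using Suc[of "Suc m"] by simp
qed simp

section \<open>Cap diagrams as runs of the stack\<close>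

text \<open>\<open>accepts s u w\<close>: the labels \<open>u\<close> of \<open>g\<close> are one of the choices counted by \<open>cnt dots_left s w\<close>.\<close>

primrec accepts ::
  "vertex_label list \<Rightarrow> vertex_label list \<Rightarrow> vertex_label list \<Rightarrow> bool" where
  "accepts s u [] = (u = [] \<and> dots_left s)"
| "accepts s u (y # w) = (case u of
      [] \<Rightarrow> False
    | x # u' \<Rightarrow> (case x of
          Dot \<Rightarrow> accepts (y # s) u' w
        | Cross \<Rightarrow> (case s of [] \<Rightarrow> False | z # t \<Rightarrow> z \<noteq> y \<and> accepts t u' w)))"

lemma accepts_length: "accepts s u w \<Longrightarrow> length u = length w"
  by (induction w arbitrary: s u) (auto split: list.splits vertex_label.splits)

lemma card_accepts:
  "finite {u. accepts s u w} \<and> card {u. accepts s u w} = cnt dots_left s w"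
proof (induction w arbitrary: s)
  case Nil
  have "{u. accepts s u []} = (if dots_left s then {[]} else {})" by auto
  then show ?case by simp
next
  case (Cons y w)
  define B where "B = (case s of [] \<Rightarrow> {} | z # t \<Rightarrow> if z \<noteq> y then {u. accepts t u w} else {})"
  have "{u. accepts s u (y # w)} = (#) Dot ` {u. accepts (y # s) u w} \<union> (#) Cross ` B"
  proof (rule set_eqI)
    fix v
    show "v \<in> {u. accepts s u (y # w)} \<longleftrightarrow>
        v \<in> (#) Dot ` {u. accepts (y # s) u w} \<union> (#) Cross ` B"
    proof (cases v)
      case (Cons x u)
      then show ?thesis by (cases x) (auto simp: B_def split: list.splits)
    qed auto
  qed
  moreover have "finite B" "card B = (case s of [] \<Rightarrow> 0 | z # t \<Rightarrow> if z \<noteq> y then cnt dots_left t w else 0)"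
    using Cons by (auto simp: B_def split: list.splits)
  moreover have "card ((#) Dot ` {u. accepts (y # s) u w} \<union> (#) Cross ` B)
      = card ((#) Dot ` {u. accepts (y # s) u w}) + card ((#) Cross ` B)"
    using Cons[of "y # s"] \<open>finite B\<close> by (intro card_Un_disjoint) auto
  ultimately show ?case using Cons[of "y # s"] by (simp add: card_image)
qed

section \<open>The right-to-left construction of caps\<close>

lemma not_Dot_iff [simp]: "x \<noteq> Dot \<longleftrightarrow> x = Cross"
  by (cases x) auto

lemma vertex_label_eqI: "(x = Cross \<longleftrightarrow> y = Cross) \<Longrightarrow> x = y"
  by (cases x; cases y) auto

lemma dots_left_map: "dots_left (map f xs) \<longleftrightarrow> (\<forall>e \<in> set xs. f e = Dot)"
proof -
  have "f e = Dot \<longleftrightarrow> f e \<noteq> Cross" for e by (cases "f e") auto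
  then show ?thesis by force
qed

lemma in_crosses_iff [simp]: "x \<in> crosses g \<longleftrightarrow> g x = Cross"
  by (simp add: crosses_def)

lemma F_iff_finite_crosses: "g \<in> F \<longleftrightarrow> finite (crosses g)"
  by (simp add: F_def crosses_def vimage_def)

lemma add_caps_append: "add_caps g (xs @ ys) D = add_caps g ys (add_caps g xs D)"
  by (induction xs arbitrary: D) auto

text \<open>A stage of the construction of \<open>D_cap\<close>, indexed by position so that it can
  be compared with the scan of the window.\<close>

definition caps_from :: "weight_diagram \<Rightarrow> int \<Rightarrow> (int \<times> int) set" where
  "caps_from g x = add_caps g (rev (sorted_list_of_set (crosses g \<inter> {x..}))) {}"

lemma D_cap_eq_caps_from: "crosses g \<subseteq> {x..} \<Longrightarrow> D_cap g = caps_from g x"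
  by (simp add: D_cap_def caps_from_def cross_list_def Int_absorb2)

lemma caps_from_Dot:
  assumes "g x = Dot"
  shows "caps_from g x = caps_from g (x + 1)"
proof -
  have "y = x \<or> x + 1 \<le> y" if "x \<le> y" for y using that by auto
  then have "crosses g \<inter> {x..} = crosses g \<inter> {x + 1..}" using assms by fastforce
  then show ?thesis by (simp add: caps_from_def)
qed

lemma caps_from_Cross:
  assumes "finite (crosses g)" "g x = Cross"
  shows "caps_from g x = insert (x, cap_end g (caps_from g (x + 1)) x) (caps_from g (x + 1))"
proof -
  let ?A = "crosses g \<inter> {x..}"
  have fin: "finite ?A" using assms by simp
  have "Min ?A = x" using assms fin by (intro Min_eqI) auto
  moreover have "?A - {x} = crosses g \<inter> {x + 1..}" by auto
  moreover have "?A \<noteq> {}" using assms by auto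
  ultimately have "sorted_list_of_set ?A = x # sorted_list_of_set (crosses g \<inter> {x + 1..})"
    using sorted_list_of_set_nonempty[of ?A] fin by simp
  then show ?thesis by (simp add: caps_from_def add_caps_append)
qed

text \<open>Minimality means that no free dot is left strictly under the new cap.\<close>

lemma cap_end:
  assumes "finite (crosses g)" "finite D"
  shows "b < cap_end g D b" "g (cap_end g D b) = Dot" "cap_end g D b \<notin> snd ` D"
    "{b<..<cap_end g D b} \<subseteq> crosses g \<union> snd ` D"
proof -
  define P where "P e \<longleftrightarrow> e > b \<and> g e = Dot \<and> e \<notin> snd ` D" for e
  \<comment> \<open>Since \<open>LEAST\<close> on the integers needs an existing minimum: only
    finitely many positions are blocked, so some admissible \<open>e0\<close> exists, and the
    minimum is sought in the finite interval up to it.\<close>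
  have "\<not> {b<..} \<subseteq> crosses g \<union> snd ` D"
    using assms infinite_Ioi[of b] by (meson finite_UnI finite_imageI finite_subset)
  then obtain e0 where e0: "P e0" unfolding P_def by fastforce
  let ?A = "{e \<in> {b<..e0}. P e}"
  have fin: "finite ?A" by (rule finite_subset[of _ "{b<..e0}"]) auto
  have ne: "?A \<noteq> {}" using e0 by (auto simp: P_def)
  have least: "Min ?A \<le> y" if "P y" for y
  proof (cases "y \<le> e0")
    case True
    with that have "y \<in> ?A" by (simp add: P_def)
    with fin show ?thesis by (rule Min_le)
  next
    case False
    then show ?thesis using Min_in[OF fin ne] by auto
  qed
  moreover have P: "P (Min ?A)" using Min_in[OF fin ne] by blast
  ultimately have eq: "cap_end g D b = Min ?A"
    unfolding cap_end_def P_def[symmetric] by (intro Least_equality)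
  show "b < cap_end g D b" "g (cap_end g D b) = Dot" "cap_end g D b \<notin> snd ` D"
    using P unfolding eq P_def by auto
  show "{b<..<cap_end g D b} \<subseteq> crosses g \<union> snd ` D"
    using least unfolding eq P_def by fastforce
qed

text \<open>Descending induction from beyond the last cross, where there are no caps. The clause on
  the interior of a cap survives later insertions because its right-hand side only grows.\<close>

lemma caps_from_invariant:
  assumes "finite (crosses g)"
  shows "finite (caps_from g x) \<and> fst ` caps_from g x = crosses g \<inter> {x..}
    \<and> inj_on fst (caps_from g x) \<and> inj_on snd (caps_from g x)
    \<and> (\<forall>(b, e) \<in> caps_from g x. b < e \<and> g e = Dot
         \<and> {b<..<e} \<subseteq> crosses g \<union> snd ` caps_from g x)"
    (is "?P x")
proof -
  obtain M where M: "\<And>y. y \<in> crosses g \<Longrightarrow> y \<le> M"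
    using assms by (meson Max_ge)
  have above: "?P y" if "M < y" for y
  proof -
    have "crosses g \<inter> {y..} = {}" using M that by fastforce
    then show ?thesis by (simp add: caps_from_def)
  qed
  show ?thesis
  proof (cases "x \<le> M + 1")
    case True
    then show ?thesis
    proof (induction x rule: int_le_induct)
      case base
      show ?case by (rule above) simp
    next
      case (step i)
      let ?x = "i - 1"
      let ?D = "caps_from g i"
      have D: "finite ?D" "fst ` ?D = crosses g \<inter> {i..}" "inj_on fst ?D" "inj_on snd ?D"
        "\<And>b e. (b, e) \<in> ?D \<Longrightarrow> b < e \<and> g e = Dot \<and> {b<..<e} \<subseteq> crosses g \<union> snd ` ?D"
        using step.IH by auto
      show ?case
      proof (cases "g ?x")
        case Dot
        have "crosses g \<inter> {?x..} = crosses g \<inter> {i..}"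
        proof -
          have "y = ?x \<or> i \<le> y" if "?x \<le> y" for y using that by auto
          then show ?thesis using Dot by fastforce
        qed
        then show ?thesis using step.IH caps_from_Dot[of g ?x, OF Dot] by simp
      next
        case Cross
        define e where "e = cap_end g ?D ?x"
        have eq: "caps_from g ?x = insert (?x, e) ?D"
          using caps_from_Cross[OF assms Cross] by (simp add: e_def)
        note e = cap_end[OF assms D(1), of ?x, folded e_def]
        have notin: "?x \<notin> fst ` ?D" unfolding D(2) by simp
        have "crosses g \<inter> {?x..} = insert ?x (crosses g \<inter> {i..})" using Cross by auto
        moreover have "\<forall>(b, e') \<in> insert (?x, e) ?D. b < e' \<and> g e' = Dot
            \<and> {b<..<e'} \<subseteq> crosses g \<union> snd ` insert (?x, e) ?D"
          using D(5) e by fastforce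
        moreover have "inj_on fst (insert (?x, e) ?D)" "inj_on snd (insert (?x, e) ?D)"
          using D(3,4) notin e(3) by (auto simp: inj_on_insert)
        ultimately show ?thesis
          unfolding eq using D(1,2) by simp
      qed
    qed
  next
    case False
    then show ?thesis using above[of x] by simp
  qed
qed

lemma caps_from_props:
  assumes "finite (crosses g)"
  shows finite_caps_from: "finite (caps_from g x)"
    and fst_caps_from: "fst ` caps_from g x = crosses g \<inter> {x..}"
    and inj_on_fst_caps_from: "inj_on fst (caps_from g x)"
    and inj_on_snd_caps_from: "inj_on snd (caps_from g x)"
    and caps_fromD: "(b, e) \<in> caps_from g x \<Longrightarrow> b < e \<and> g e = Dot
         \<and> {b<..<e} \<subseteq> crosses g \<union> snd ` caps_from g x"
  using caps_from_invariant[OF assms, of x] by auto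

lemma caps_from_mono:
  assumes "finite (crosses g)" "x \<le> y"
  shows "caps_from g y \<subseteq> caps_from g x"
  using assms(2)
proof (induction x rule: int_le_induct)
  case (step i)
  have "caps_from g i \<subseteq> caps_from g (i - 1)"
    using caps_from_Dot[of g "i - 1"] caps_from_Cross[OF assms(1), of "i - 1"]
    by (cases "g (i - 1)") auto
  with step.IH show ?case by blast
qed simp

text \<open>The stack after the scan from the right has reached \<open>x\<close>; in increasing
  order its top, the nearest free dot, comes first.\<close>

definition free_dots :: "weight_diagram \<Rightarrow> int \<Rightarrow> int \<Rightarrow> int set" where
  "free_dots g u x = {e \<in> {x..<u}. g e = Dot \<and> e \<notin> snd ` caps_from g x}"

lemma finite_free_dots [simp]: "finite (free_dots g u x)"
  by (rule finite_subset[of _ "{x..<u}"]) (auto simp: free_dots_def)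

text \<open>Caps built so far start and end to the right of \<open>x\<close>, so \<open>x\<close> is
  free and, being smallest, becomes the new top.\<close>

lemma free_dots_Dot:
  assumes "finite (crosses g)" "g x = Dot" "x < u"
  shows "sorted_list_of_set (free_dots g u x) = x # sorted_list_of_set (free_dots g u (x + 1))"
proof -
  have "x \<notin> snd ` caps_from g (x + 1)"
  proof
    assume "x \<in> snd ` caps_from g (x + 1)"
    then obtain b where b: "(b, x) \<in> caps_from g (x + 1)" by force
    then have "b \<in> crosses g \<inter> {x + 1..}" unfolding fst_caps_from[OF assms(1), symmetric] by force
    with caps_fromD[OF assms(1) b] show False by simp
  qed
  moreover have "x \<le> y \<longleftrightarrow> y = x \<or> x + 1 \<le> y" for y by auto
  ultimately have eq: "free_dots g u x = insert x (free_dots g u (x + 1))"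
    using assms(2,3) unfolding free_dots_def caps_from_Dot[of g x, OF assms(2)] by auto
  have "Min (free_dots g u x) = x"
    by (rule Min_eqI) (auto simp: eq, auto simp: free_dots_def)
  moreover have "free_dots g u x - {x} = free_dots g u (x + 1)"
    unfolding eq by (auto simp: free_dots_def)
  ultimately show ?thesis
    using sorted_list_of_set_nonempty[of "free_dots g u x"] eq by simp
qed

text \<open>The new cap ends at the top of the stack; if the stack is empty, it ends outside the
  window.\<close>

lemma free_dots_Cross:
  assumes "finite (crosses g)" "g x = Cross" "x < u"
  defines "e \<equiv> cap_end g (caps_from g (x + 1)) x"
  shows "free_dots g u x = free_dots g u (x + 1) - {e}"
    and "e < u \<longleftrightarrow> e \<in> free_dots g u (x + 1)"
    and "y \<in> free_dots g u (x + 1) \<Longrightarrow> e \<le> y"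
proof -
  note e = cap_end[OF assms(1) finite_caps_from[OF assms(1), of "x + 1"], of x, folded e_def]
  show "free_dots g u x = free_dots g u (x + 1) - {e}"
    using assms(2) unfolding free_dots_def caps_from_Cross[OF assms(1,2), folded e_def]
    by (auto simp: order_le_less)
  show "e < u \<longleftrightarrow> e \<in> free_dots g u (x + 1)"
    using e by (auto simp: free_dots_def)
  show "e \<le> y" if "y \<in> free_dots g u (x + 1)"
  proof (rule ccontr)
    assume "\<not> e \<le> y"
    with that have "y \<in> {x<..<e}" by (auto simp: free_dots_def)
    with e(4) have "y \<in> crosses g \<union> snd ` caps_from g (x + 1)" by blast
    with that show False by (auto simp: free_dots_def)
  qed
qed

text \<open>The left side continues from the stack reached at \<open>x\<close>; the right side
  concerns only the caps still to be drawn and the final free dots. The induction lengthens the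
  unread part upwards from \<open>l\<close>.\<close>

lemma accepts_iff_caps:
  assumes "finite (crosses g)" "l \<le> x" "x \<le> u"
  shows "accepts (map f (sorted_list_of_set (free_dots g u x)))
           (map g (rev [l..x - 1])) (map f (rev [l..x - 1])) \<longleftrightarrow>
      (\<forall>(b, e) \<in> caps_from g l. b < x \<longrightarrow> e < u \<and> f b \<noteq> f e)
      \<and> (\<forall>e \<in> free_dots g u l. f e = Dot)"
  using assms(2,3)
proof (induction x rule: int_ge_induct)
  case base
  have "\<not> b < l" if "(b, e) \<in> caps_from g l" for b e
    using fst_caps_from[OF assms(1), of l] that by force
  then show ?case by (auto simp: dots_left_map simp del: set_map)
next
  case (step x)
  note IH = step.IH[OF order_trans[OF _ step.prems]]
  have rev: "rev [l..x + 1 - 1] = x # rev [l..x - 1]"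
    using step.hyps by (simp add: upto_rec2)
  show ?case
  proof (cases "g x")
    case Dot
    have "b \<noteq> x" if "(b, e) \<in> caps_from g l" for b e
      using fst_caps_from[OF assms(1), of l] that Dot by force
    then have "(\<forall>(b, e) \<in> caps_from g l. b < x + 1 \<longrightarrow> e < u \<and> f b \<noteq> f e)
        \<longleftrightarrow> (\<forall>(b, e) \<in> caps_from g l. b < x \<longrightarrow> e < u \<and> f b \<noteq> f e)" by fastforce
    then show ?thesis
      using IH step.prems unfolding rev by (simp add: Dot free_dots_Dot[OF assms(1) Dot])
  next
    case Cross
    define e where "e = cap_end g (caps_from g (x + 1)) x"
    have "x < u" using step.prems by simp
    note free = free_dots_Cross[OF assms(1) Cross \<open>x < u\<close>, folded e_def]
    have "(x, e) \<in> caps_from g l"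
      using caps_from_mono[OF assms(1) step.hyps] caps_from_Cross[OF assms(1) Cross, folded e_def]
      by blast
    then have cap: "(x, e') \<in> caps_from g l \<longleftrightarrow> e' = e" for e'
      using inj_onD[OF inj_on_fst_caps_from[OF assms(1), of l], of "(x, e)" "(x, e')"] by auto
    \<comment> \<open>Exactly one cap starts at \<open>x\<close>, so its condition separates from
      the induction hypothesis.\<close>
    have split: "(\<forall>(b, e) \<in> caps_from g l. b < x + 1 \<longrightarrow> e < u \<and> f b \<noteq> f e)
        \<longleftrightarrow> (e < u \<and> f x \<noteq> f e) \<and> (\<forall>(b, e) \<in> caps_from g l. b < x \<longrightarrow> e < u \<and> f b \<noteq> f e)"
      (is "?l \<longleftrightarrow> ?r")
    proof
      assume ?l then show ?r using cap by fastforce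
    next
      assume r: ?r
      show ?l
      proof (clarify, goal_cases)
        case (1 b e')
        then show ?case using r cap by (cases "b = x") auto
      qed
    qed
    show ?thesis
    proof (cases "e < u")
      case False
      then have "free_dots g u (x + 1) = {}"
        using free(3) by (fastforce simp: free_dots_def)
      then show ?thesis unfolding rev split using False by (simp add: Cross)
    next
      case True
      then have "Min (free_dots g u (x + 1)) = e" "free_dots g u (x + 1) \<noteq> {}"
        using free(2,3) by (auto intro!: Min_eqI)
      then have "sorted_list_of_set (free_dots g u (x + 1))
          = e # sorted_list_of_set (free_dots g u x)"
        using sorted_list_of_set_nonempty[of "free_dots g u (x + 1)"] free(1) by simp
      then show ?thesis unfolding rev split using IH True by (auto simp: Cross)
    qed
  qed
qed

lemma accepts_iff_D_cap:
  assumes "crosses g \<subseteq> {l..<u}" "l \<le> u"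
  shows "accepts [] (map g (rev [l..u - 1])) (map f (rev [l..u - 1])) \<longleftrightarrow>
      (\<forall>(b, e) \<in> D_cap g. e < u \<and> f b \<noteq> f e)
      \<and> (\<forall>e \<in> {l..<u} - (fst ` D_cap g \<union> snd ` D_cap g). f e = Dot)"
proof -
  have fin: "finite (crosses g)" using assms(1) by (rule finite_subset) simp
  have D: "D_cap g = caps_from g l" using assms by (intro D_cap_eq_caps_from) auto
  have "crosses g \<inter> {l..} = crosses g" using assms by auto
  then have fst: "fst ` D_cap g = crosses g" using fst_caps_from[OF fin, of l] D by simp
  have "b < u" if cap: "(b, e) \<in> D_cap g" for b e
  proof -
    have "b \<in> crosses g" unfolding fst[symmetric] using cap by force
    then show ?thesis using assms(1) by auto
  qed
  then have left: "(\<forall>(b, e) \<in> D_cap g. b < u \<longrightarrow> e < u \<and> f b \<noteq> f e)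
      \<longleftrightarrow> (\<forall>(b, e) \<in> D_cap g. e < u \<and> f b \<noteq> f e)" by blast
  have empty: "free_dots g u u = {}" by (simp add: free_dots_def)
  have free: "free_dots g u l = {l..<u} - (fst ` D_cap g \<union> snd ` D_cap g)"
    unfolding fst by (auto simp: free_dots_def D)
  show ?thesis
    using accepts_iff_caps[OF fin assms(2) order_refl, of f]
    unfolding D[symmetric] left free empty by simp
qed

section \<open>Lengths and endpoints of caps; the finite window\<close>

lemma
  assumes "finite (crosses g)"
  shows finite_D_cap: "finite (D_cap g)"
    and fst_D_cap: "fst ` D_cap g = crosses g"
    and inj_on_fst_D_cap: "inj_on fst (D_cap g)"
    and inj_on_snd_D_cap: "inj_on snd (D_cap g)"
    and D_capD: "(b, e) \<in> D_cap g \<Longrightarrow> b < e \<and> g e = Dot \<and> {b<..<e} \<subseteq> crosses g \<union> snd ` D_cap g"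
proof -
  obtain x where x: "\<And>y. y \<in> crosses g \<Longrightarrow> x \<le> y"
    using Min_le[OF assms] by blast
  then have D: "D_cap g = caps_from g x" by (intro D_cap_eq_caps_from) auto
  have "crosses g \<inter> {x..} = crosses g" using x by auto
  with finite_caps_from[OF assms, of x] fst_caps_from[OF assms, of x]
    inj_on_fst_caps_from[OF assms, of x] inj_on_snd_caps_from[OF assms, of x]
    caps_fromD[OF assms, of b e x] show
    "finite (D_cap g)" "fst ` D_cap g = crosses g" "inj_on fst (D_cap g)" "inj_on snd (D_cap g)"
    "(b, e) \<in> D_cap g \<Longrightarrow> b < e \<and> g e = Dot \<and> {b<..<e} \<subseteq> crosses g \<union> snd ` D_cap g"
    unfolding D by auto
qed

lemma card_D_cap: "finite (crosses g) \<Longrightarrow> card (D_cap g) = num_crosses g"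
  using card_image[OF inj_on_fst_D_cap, of g] fst_D_cap[of g] by (simp add: num_crosses_def)

text \<open>Each position strictly under a cap is a cross of \<open>g\<close> or the end of a cap,
  and there are at most \<open>num_crosses g\<close> of each.\<close>

lemma cap_length:
  assumes "finite (crosses g)" "(b, e) \<in> D_cap g"
  shows "e - b \<le> 2 * int (num_crosses g) + 1"
proof -
  have "card {b<..<e} \<le> card (crosses g \<union> snd ` D_cap g)"
    using assms D_capD[OF assms] finite_D_cap by (intro card_mono) auto
  also have "\<dots> \<le> card (crosses g) + card (snd ` D_cap g)" by (rule card_Un_le)
  also have "card (snd ` D_cap g) \<le> card (D_cap g)"
    using finite_D_cap[OF assms(1)] by (rule card_image_le)
  finally have "card {b<..<e} \<le> 2 * num_crosses g"
    using card_D_cap[OF assms(1)] by (simp add: num_crosses_def)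
  then show ?thesis by simp
qed

lemma cap_matches_iff: "cap_matches D f \<longleftrightarrow> (\<forall>(b, e) \<in> D. f b \<noteq> f e)"
proof -
  have "(x = Dot \<and> y = Cross \<or> y = Dot \<and> x = Cross) \<longleftrightarrow> x \<noteq> y" for x y
    by (cases x; cases y) auto
  then show ?thesis unfolding cap_matches_def by simp
qed

text \<open>Each cap carries exactly one cross of f, selected by \<open>\<phi>\<close>. Distinct
  caps share no endpoint, because starts are crosses and ends are dots of \<open>g\<close>.\<close>

lemma card_crosses_endpoints:
  assumes "finite (crosses g)" "cap_matches (D_cap g) f"
  shows "card (crosses f \<inter> (fst ` D_cap g \<union> snd ` D_cap g)) = num_crosses g"
proof -
  define \<phi> where "\<phi> c = (if f (fst c) = Cross then fst c else snd c)" for c :: "int \<times> int"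
  have matched: "f (fst c) \<noteq> f (snd c)" if "c \<in> D_cap g" for c
    using assms(2) that by (auto simp: cap_matches_iff)
  have "crosses f \<inter> (fst ` D_cap g \<union> snd ` D_cap g) = \<phi> ` D_cap g"
  proof (intro equalityI subsetI)
    fix x assume x: "x \<in> crosses f \<inter> (fst ` D_cap g \<union> snd ` D_cap g)"
    then obtain c where c: "c \<in> D_cap g" "x = fst c \<or> x = snd c" by blast
    then have "x = \<phi> c" using matched[OF c(1)] x by (auto simp: \<phi>_def)
    with c(1) show "x \<in> \<phi> ` D_cap g" by blast
  next
    fix x assume "x \<in> \<phi> ` D_cap g"
    then obtain c where c: "c \<in> D_cap g" "x = \<phi> c" by blast
    then have "f x = Cross" using matched[OF c(1)] by (cases "f (snd c)") (auto simp: \<phi>_def)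
    with c show "x \<in> crosses f \<inter> (fst ` D_cap g \<union> snd ` D_cap g)" by (auto simp: \<phi>_def)
  qed
  moreover have "inj_on \<phi> (D_cap g)"
  proof (rule inj_onI)
    fix c d assume cd: "c \<in> D_cap g" "d \<in> D_cap g" "\<phi> c = \<phi> d"
    have "g (fst c) = Cross \<and> g (snd c) = Dot" if "c \<in> D_cap g" for c
      using that D_capD[OF assms(1), of "fst c" "snd c"] fst_D_cap[OF assms(1)] by auto
    from this[OF cd(1)] this[OF cd(2)] have "fst c \<noteq> snd d" "fst d \<noteq> snd c" by auto
    then show "c = d"
      using cd inj_onD[OF inj_on_fst_D_cap[OF assms(1)]] inj_onD[OF inj_on_snd_D_cap[OF assms(1)]]
      by (auto simp: \<phi>_def split: if_splits)
  qed
  ultimately show ?thesis using card_image[of \<phi> "D_cap g"] card_D_cap[OF assms(1)] by simp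
qed

text \<open>A cap has length at most \<open>2r + 1\<close> and meets a cross of \<open>f\<close>, so a finite window sees everything.
  Conversely, exhausting the crosses of \<open>f\<close> by matched caps forces \<open>g\<close> to have \<open>r\<close> crosses.\<close>

lemma flat_eq:
  assumes fin: "finite (crosses f)" and r: "num_crosses f = r" and K: "crosses f \<subseteq> {- K..K}" "0 \<le> K"
  defines "l \<equiv> - K - 2 * int r - 1" and "u \<equiv> K + 2 * int r + 2"
  shows "flat f = {g. crosses g \<subseteq> {l..<u}
    \<and> accepts [] (map g (rev [l..u - 1])) (map f (rev [l..u - 1]))}"
proof (intro set_eqI iffI; clarify?)
  fix g assume "g \<in> flat f"
  then have fing: "finite (crosses g)" and rg: "num_crosses g = r" and matches: "cap_matches (D_cap g) f"
    by (auto simp: flat_def F_r_def r F_iff_finite_crosses)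
  \<comment> \<open>A matched cap has an endpoint in \<open>{- K..K}\<close> and length at most
    \<open>2 * int r + 1\<close>, which dictates the margins in \<open>l\<close> and
    \<open>u\<close>.\<close>
  have window: "l \<le> b \<and> b < u \<and> e < u" if cap: "(b, e) \<in> D_cap g" for b e
  proof -
    have "f b = Cross \<or> f e = Cross" using matches cap by (auto simp: cap_matches_def)
    then have "b \<in> {- K..K} \<or> e \<in> {- K..K}" using K(1) by auto
    then show ?thesis
      using cap_length[OF fing cap] D_capD[OF fing cap] by (auto simp: l_def u_def rg)
  qed
  have sub: "crosses g \<subseteq> {l..<u}"
    using window fst_D_cap[OF fing] by fastforce
  have "crosses f \<inter> (fst ` D_cap g \<union> snd ` D_cap g) = crosses f"
    using card_crosses_endpoints[OF fing matches] fin r rg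
    by (intro card_subset_eq) (auto simp: num_crosses_def)
  then have "e \<notin> crosses f" if "e \<notin> fst ` D_cap g \<union> snd ` D_cap g" for e
    using that by blast
  then have "f e = Dot" if "e \<notin> fst ` D_cap g \<union> snd ` D_cap g" for e
    using that by (cases "f e") auto
  moreover have "l \<le> u" using K(2) by (simp add: l_def u_def)
  moreover have "\<forall>(b, e) \<in> D_cap g. e < u \<and> f b \<noteq> f e"
    using window matches by (auto simp: cap_matches_iff)
  ultimately show "crosses g \<subseteq> {l..<u}
    \<and> accepts [] (map g (rev [l..u - 1])) (map f (rev [l..u - 1]))"
    using sub accepts_iff_D_cap[OF sub, of f] by blast
next
  fix g assume sub: "crosses g \<subseteq> {l..<u}"
    and acc: "accepts [] (map g (rev [l..u - 1])) (map f (rev [l..u - 1]))"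
  have fing: "finite (crosses g)" using sub by (rule finite_subset) simp
  have lu: "l \<le> u" using K(2) by (simp add: l_def u_def)
  note acc' = acc[unfolded accepts_iff_D_cap[OF sub lu]]
  then have matches: "cap_matches (D_cap g) f" by (auto simp: cap_matches_iff)
  have "crosses f \<subseteq> fst ` D_cap g \<union> snd ` D_cap g"
  proof
    fix x assume x: "x \<in> crosses f"
    then have "x \<in> {- K..K}" using K(1) by blast
    then have "x \<in> {l..<u}" by (simp add: l_def u_def)
    moreover have "f x \<noteq> Dot" using x by simp
    ultimately show "x \<in> fst ` D_cap g \<union> snd ` D_cap g"
      using acc' by blast
  qed
  then have "num_crosses g = r"
    using card_crosses_endpoints[OF fing matches] r by (simp add: Int_absorb2 num_crosses_def)
  then show "g \<in> flat f"
    using fing matches by (simp add: flat_def F_r_def r F_iff_finite_crosses)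
qed

lemma nth_rev_upto: "i < length [l..u - 1] \<Longrightarrow> rev [l..u - 1] ! i = u - 1 - int i"
  by (subst rev_nth, simp, subst nth_upto) auto

text \<open>Members of \<open>flat f\<close> have only dots outside the window, so reading them
  there is a bijection onto the accepted words.\<close>

lemma card_flat:
  assumes fin: "finite (crosses f)" and r: "num_crosses f = r" and K: "crosses f \<subseteq> {- K..K}" "0 \<le> K"
  defines "l \<equiv> - K - 2 * int r - 1" and "u \<equiv> K + 2 * int r + 2"
  shows "finite (flat f)" "card (flat f) = cnt dots_left [] (map f (rev [l..u - 1]))"
proof -
  let ?word = "\<lambda>h :: weight_diagram. map h (rev [l..u - 1])"
  note flat = flat_eq[OF fin r K, folded l_def u_def]
  have "bij_betw ?word (flat f) {v. accepts [] v (?word f)}"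
  proof (rule bij_betw_imageI)
    show "inj_on ?word (flat f)"
    proof (rule inj_onI, rule ext)
      fix g h x assume gh: "g \<in> flat f" "h \<in> flat f" "?word g = ?word h"
      then have in_window: "g x = h x" if "x \<in> {l..<u}" using that by auto
      have "crosses g \<subseteq> {l..<u}" "crosses h \<subseteq> {l..<u}" using gh(1,2) unfolding flat by auto
      then have "g x = Dot" "h x = Dot" if "x \<notin> {l..<u}"
        using that by (metis in_crosses_iff not_Dot_iff subsetD)+
      then show "g x = h x" using in_window by (cases "x \<in> {l..<u}") auto
    qed
    show "?word ` flat f = {v. accepts [] v (?word f)}"
    proof (intro set_eqI iffI)
      fix v assume "v \<in> {v. accepts [] v (?word f)}"
      then have acc: "accepts [] v (?word f)" by simp
      \<comment> \<open>Words are read from the right, so letter 0 sits at position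
        \<open>u - 1\<close>.\<close>
      define g where "g x = (if x \<in> {l..<u} then v ! nat (u - 1 - x) else Dot)" for x
      have len: "length v = length [l..u - 1]" using accepts_length[OF acc] by simp
      have "?word g = v"
        by (rule nth_equalityI) (auto simp: len nth_rev_upto g_def simp del: length_upto, auto)
      moreover have "crosses g \<subseteq> {l..<u}" by (auto simp: g_def split: if_splits)
      ultimately show "v \<in> ?word ` flat f" unfolding flat using acc by blast
    qed (auto simp: flat)
  qed
  with card_accepts[of "[]" "?word f"]
  show "finite (flat f)" "card (flat f) = cnt dots_left [] (?word f)"
    by (auto simp: bij_betw_finite bij_betw_same_card)
qed

section \<open>The bound and the case of equality\<close>

lemma count_list_map_distinct:
  "distinct xs \<Longrightarrow> count_list (map h xs) y = card {x \<in> set xs. h x = y}"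
proof (induction xs)
  case (Cons a xs)
  have "{x \<in> set (a # xs). h x = y} = (if h a = y then insert a {x \<in> set xs. h x = y}
    else {x \<in> set xs. h x = y})" by auto
  with Cons show ?case by simp
qed simp

lemma count_list_window:
  assumes "crosses f \<subseteq> {l..<u}"
  shows "count_list (map f (rev [l..u - 1])) Cross = num_crosses f"
proof -
  have "count_list (map f (rev [l..u - 1])) Cross = card {x \<in> set (rev [l..u - 1]). f x = Cross}"
    by (rule count_list_map_distinct) simp
  also have "{x \<in> set (rev [l..u - 1]). f x = Cross} = crosses f"
    using assms by auto
  finally show ?thesis by (simp add: num_crosses_def)
qed

lemma spaced_crosses_of_count_eq:
  assumes fin: "finite (crosses f)" and sub: "crosses f \<subseteq> {l..<u}"
    and eq: "real (cnt dots_left [] (map f (rev [l..u - 1]))) = catalan (Suc (num_crosses f))"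
  shows "\<exists>s. crosses f = {2 * int i + s | i. i \<in> {1..num_crosses f}}"
proof -
  define r where "r = num_crosses f"
  have "real (cnt dots_left (replicate 0 Dot) (map f (rev [l..u - 1])))
      = catalan (Suc (count_list (map f (rev [l..u - 1])) Cross))"
    unfolding count_list_window[OF sub] using eq by simp
  from cnt_dots_left_eq_catalan[OF this, unfolded count_list_window[OF sub]]
  obtain a where a: "\<And>k. k < r \<Longrightarrow> a + 2 * k < length [l..u - 1]
      \<and> map f (rev [l..u - 1]) ! (a + 2 * k) = Cross"
    unfolding r_def by auto
  \<comment> \<open>Index \<open>a + 2 * k\<close> of the reversed word is position
    \<open>u - 1 - a - 2 * k\<close>; this \<open>s\<close> turns it into \<open>2 * i + s\<close>
    with \<open>i = r - k\<close>.\<close>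
  define s where "s = u - 1 - int a - 2 * int r"
  define h where "h i = 2 * int i + s" for i
  have "h ` {1..r} \<subseteq> crosses f"
  proof clarify
    fix i assume "i \<in> {1..r}"
    then have i: "1 \<le> i" "i \<le> r" by auto
    then have *: "a + 2 * (r - i) < length [l..u - 1]" "map f (rev [l..u - 1]) ! (a + 2 * (r - i)) = Cross"
      using a[of "r - i"] by auto
    then have "f (rev [l..u - 1] ! (a + 2 * (r - i))) = Cross" by simp
    then have "f (u - 1 - int (a + 2 * (r - i))) = Cross" unfolding nth_rev_upto[OF *(1)] .
    also have "u - 1 - int (a + 2 * (r - i)) = h i"
      using i by (simp add: h_def s_def of_nat_diff)
    finally show "h i \<in> crosses f" by simp
  qed
  moreover have "card (h ` {1..r}) = card (crosses f)"
    by (subst card_image) (auto simp: h_def inj_on_def r_def num_crosses_def)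
  ultimately have "h ` {1..r} = crosses f" using fin by (intro card_subset_eq)
  moreover have "h ` {1..r} = {2 * int i + s | i. i \<in> {1..r}}" by (auto simp: h_def)
  ultimately have "crosses f = {2 * int i + s | i. i \<in> {1..r}}" by simp
  then show ?thesis unfolding r_def by blast
qed

text \<open>The margin on the right puts a dot on the stack before the first cross is read; the one
  on the left leaves room for the dot that completes the last alternating pair.\<close>

lemma cnt_spaced_crosses:
  assumes f: "crosses f = {2 * int i + s | i. i \<in> {1..r}}" and sub: "crosses f \<subseteq> {l + 1..<u - 1}"
  shows "real (cnt dots_left [] (map f (rev [l..u - 1]))) = catalan (Suc r)"
proof (cases r)
  case 0
  with f have "f x = Dot" for x using in_crosses_iff[of x f] by (cases "f x") auto
  then have "map f (rev [l..u - 1]) = replicate (length [l..u - 1]) Dot"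
    by (intro nth_equalityI) auto
  then show ?thesis using cnt_dots_left_replicate[of 0] by (simp add: 0 catalan_Suc del: length_upto)
next
  case (Suc r')
  have mem: "2 * int i + s \<in> crosses f" if "1 \<le> i" "i \<le> r" for i using that unfolding f by auto
  have "2 * int r + s \<in> crosses f" "2 + s \<in> crosses f"
    using mem[of r] mem[of 1] Suc by auto
  then have bounds: "2 * int r + s < u - 1" "l + 1 \<le> 2 + s"
    using sub by (force, force)
  define a where "a = nat (u - 2 - 2 * int r - s)"
  define q where "q = nat (s + 1 - l)"
  have a: "int (Suc a) = u - 1 - 2 * int r - s" and q: "int q = s + 1 - l"
    using bounds by (auto simp: a_def q_def)
  have len: "length [l..u - 1] = Suc a + (2 * r + q)"
  proof -
    have "int (length [l..u - 1]) = int (Suc a + (2 * r + q))"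
      using bounds unfolding of_nat_add a by (simp add: q)
    then show ?thesis by linarith
  qed
  have "map f (rev [l..u - 1]) = replicate (Suc a) Dot @ alternating Cross Dot r @ replicate q Dot"
  proof (rule nth_equalityI)
    fix j assume "j < length (map f (rev [l..u - 1]))"
    then have j: "j < length [l..u - 1]" by simp
    \<comment> \<open>The distance leftwards from the rightmost cross, negative on the leading
      dots.\<close>
    define t where "t = int j - int (Suc a)"
    have "map f (rev [l..u - 1]) ! j = f (u - 1 - int j)"
      using j nth_rev_upto[OF j] by simp
    also have "u - 1 - int j = 2 * int r + s - t" using a by (simp add: t_def)
    finally have lhs: "map f (rev [l..u - 1]) ! j = f (2 * int r + s - t)" .
    have cross: "f (2 * int r + s - t) = Cross \<longleftrightarrow> even t \<and> 0 \<le> t \<and> t < 2 * int r"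
    proof -
      have "f (2 * int r + s - t) = Cross \<longleftrightarrow> (\<exists>i\<in>{1..r}. t = 2 * int r - 2 * int i)"
        unfolding in_crosses_iff[symmetric] f by force
      also have "\<dots> \<longleftrightarrow> even t \<and> 0 \<le> t \<and> t < 2 * int r"
      proof
        assume "even t \<and> 0 \<le> t \<and> t < 2 * int r"
        moreover from this obtain m where "t = 2 * m" by (auto elim: evenE)
        ultimately show "\<exists>i\<in>{1..r}. t = 2 * int r - 2 * int i"
          by (intro bexI[of _ "nat (int r - m)"]) auto
      qed auto
      finally show ?thesis .
    qed
    have rhs: "(replicate (Suc a) Dot @ alternating Cross Dot r @ replicate q Dot) ! j = Cross
        \<longleftrightarrow> even t \<and> 0 \<le> t \<and> t < 2 * int r"
    proof (cases "j < Suc a")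
      case True
      then show ?thesis by (simp add: nth_append t_def del: replicate_Suc)
    next
      case False
      then obtain m where m: "j = Suc a + m" by (metis le_add_diff_inverse not_less)
      with j len have "m < 2 * r + q" by simp
      then show ?thesis
        by (auto simp: m nth_append t_def nth_alternating simp del: replicate_Suc)
    qed
    show "map f (rev [l..u - 1]) ! j
        = (replicate (Suc a) Dot @ alternating Cross Dot r @ replicate q Dot) ! j"
      unfolding lhs by (rule vertex_label_eqI) (simp only: cross rhs)
  qed (simp only: length_map length_rev len length_append length_replicate length_alternating)
  then show ?thesis
    using cnt_dots_left_replicate_append[of 0 "Suc a"] cnt_dots_left_alternating[of a r q]
    by (simp del: replicate_Suc)
qed

section \<open>Equality with \<open>p r\<close> up to shift\<close>

lemma crosses_p: "crosses (p r) = {2 * int i | i. i \<in> {1..r}}"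
proof -
  have "p r x = Cross \<longleftrightarrow> x \<in> {2 * int i | i. i \<in> {1..r}}" for x
    unfolding p_def by (simp del: mem_Collect_eq)
  then show ?thesis unfolding crosses_def by blast
qed

lemma sorted_list_spaced:
  "sorted_list_of_set {2 * int i + s | i. i \<in> {1..r}} = map (\<lambda>i. 2 * int (Suc i) + s) [0..<r]"
proof -
  have "{2 * int i + s | i. i \<in> {1..r}} = (\<lambda>i. 2 * int (Suc i) + s) ` {0..<r}"
  proof -
    have "{2 * int i + s | i. i \<in> {1..r}} = (\<lambda>i. 2 * int i + s) ` {1..r}" by auto
    also have "\<dots> = (\<lambda>i. 2 * int i + s) ` Suc ` {0..<r}"
      by (simp add: image_Suc_atLeastLessThan atLeastLessThanSuc_atLeastAtMost del: of_nat_Suc)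
    finally show ?thesis by (simp only: image_image)
  qed
  also have "\<dots> = set (map (\<lambda>i. 2 * int (Suc i) + s) [0..<r])" by simp
  finally have "{2 * int i + s | i. i \<in> {1..r}} = set (map (\<lambda>i. 2 * int (Suc i) + s) [0..<r])" .
  moreover have "sorted_wrt (<) (map (\<lambda>i. 2 * int (Suc i) + s) [0..<r])"
    by (auto simp: sorted_wrt_iff_nth_less)
  ultimately show ?thesis
    by (simp only: strict_sorted_iff sorted_list_of_set.idem_if_sorted_distinct)
qed

lemma equal_up_to_shift_p_iff:
  assumes fin: "finite (crosses f)" and r: "num_crosses f = r"
  shows "equal_up_to_shift f (p r) \<longleftrightarrow> (\<exists>s. crosses f = {2 * int i + s | i. i \<in> {1..r}})"
proof -
  have p_list: "cross_list (p r) = map (\<lambda>i. 2 * int (Suc i)) [0..<r]"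
    using sorted_list_spaced[of 0 r] by (simp add: cross_list_def crosses_p)
  have p_num: "num_crosses (p r) = r"
  proof -
    have "crosses (p r) = (\<lambda>i. 2 * int i) ` {1..r}" by (auto simp: crosses_p)
    then show ?thesis unfolding num_crosses_def by (simp add: card_image inj_on_def)
  qed
  have len: "length (cross_list f) = r" using r fin by (simp add: cross_list_def num_crosses_def)
  have set: "set (cross_list f) = crosses f" using fin by (simp add: cross_list_def)
  show ?thesis
  proof
    assume shift: "equal_up_to_shift f (p r)"
    \<comment> \<open>For \<open>r = 0\<close> this value is unspecified, but then there is no entry
      to compare.\<close>
    define s where "s = cross_list f ! 0 - cross_list (p r) ! 0"
    have "cross_list f ! i = 2 * int (Suc i) + s" if "i < r" for i
    proof -
      have "cross_list f ! i - cross_list (p r) ! i = s"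
        using shift that order_le_less_trans[OF le0 that] unfolding equal_up_to_shift_def s_def r by blast
      then show ?thesis using that by (simp add: p_list)
    qed
    then have "cross_list f = map (\<lambda>i. 2 * int (Suc i) + s) [0..<r]"
      by (intro nth_equalityI) (auto simp: len)
    then have "cross_list f = sorted_list_of_set {2 * int i + s | i. i \<in> {1..r}}"
      by (simp only: sorted_list_spaced)
    then have "crosses f = {2 * int i + s | i. i \<in> {1..r}}"
      using set by simp
    then show "\<exists>s. crosses f = {2 * int i + s | i. i \<in> {1..r}}" ..
  next
    assume "\<exists>s. crosses f = {2 * int i + s | i. i \<in> {1..r}}"
    then obtain s where "crosses f = {2 * int i + s | i. i \<in> {1..r}}" ..
    then have "cross_list f = map (\<lambda>i. 2 * int (Suc i) + s) [0..<r]"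
      unfolding cross_list_def by (simp only: sorted_list_spaced)
    then show "equal_up_to_shift f (p r)"
      by (simp add: equal_up_to_shift_def r p_num p_list)
  qed
qed

theorem theorem0p1:
  fixes r :: nat and f :: weight_diagram
  assumes "f \<in> F_r r"
  shows "finite (flat f)
    \<and> real (card (flat f)) \<le> catalan (r + 1)
    \<and> (real (card (flat f)) = catalan (r + 1) \<longleftrightarrow> equal_up_to_shift f (p r))
    \<and> (real (card (flat f)) = catalan (r + 1) \<longleftrightarrow>
         (\<exists>s::int. f -` {Cross} = {2 * int i + s | i. i \<in> {1..r}}))"
proof -
  have fin: "finite (crosses f)" and r: "num_crosses f = r"
    using assms by (auto simp: F_r_def F_iff_finite_crosses)
  \<comment> \<open>The inserted 0 keeps the set nonempty when f has no crosses and makes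
    \<open>K\<close> nonnegative.\<close>
  define K where "K = Max (insert 0 (abs ` crosses f))"
  have "0 \<le> K" unfolding K_def using fin by (intro Max_ge) auto
  have "\<bar>x\<bar> \<le> K" if "x \<in> crosses f" for x
    unfolding K_def using fin that by (intro Max_ge) auto
  then have K: "crosses f \<subseteq> {- K..K}" by fastforce
  define l where "l = - K - 2 * int r - 1"
  define u where "u = K + 2 * int r + 2"
  note card = card_flat[OF fin r K \<open>0 \<le> K\<close>, folded l_def u_def]
  \<comment> \<open>Even for \<open>r = 0\<close> the window extends beyond \<open>{- K..K}\<close>
    on both sides, as \<open>cnt_spaced_crosses\<close> requires.\<close>
  have inner: "crosses f \<subseteq> {l + 1..<u - 1}" and sub: "crosses f \<subseteq> {l..<u}"
    using K by (auto simp: l_def u_def)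
  have "real (card (flat f)) \<le> catalan (r + 1)"
    using cnt_dots_left_le[of 0 "map f (rev [l..u - 1])"] count_list_window[OF sub]
    by (simp add: card(2) r)
  moreover have eq: "real (card (flat f)) = catalan (r + 1) \<longleftrightarrow>
         (\<exists>s::int. crosses f = {2 * int i + s | i. i \<in> {1..r}})"
    using spaced_crosses_of_count_eq[OF fin sub] cnt_spaced_crosses[OF _ inner]
    unfolding card(2) r Suc_eq_plus1[symmetric] by blast
  ultimately show ?thesis
    using card(1) equal_up_to_shift_p_iff[OF fin r] by (simp add: crosses_def)
qed

end
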